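(* In the setting below, for all $i,j,k\in\{1,\dots,q\}$: (i) $[y_i,z_j]=[\tilde y_i,\tilde z_j]=0$ and $[\tilde y_i,z_j]=-[y_i,\tilde z_j]=\delta_{ij}A_\lambda$; (ii) $[y_i,y_j]=-[z_i,z_j]$, $[\tilde y_i,\tilde y_j]=-[\tilde z_i,\tilde z_j]$, $[y_i,\tilde y_j]=-[z_i,\tilde z_j]$; (iii) $[[y_i,y_j],y_k]=[[\tilde y_i,\tilde y_j],\tilde y_k]=0$, $[[y_i,y_j],\tilde y_k]=\langle\lambda,\lambda\rangle(\delta_{jk}y_i+\delta_{ik}y_j)$, $[[\tilde y_i,\tilde y_j],y_k]=-\langle\lambda,\lambda\rangle(\delta_{jk}\tilde y_i+\delta_{ik}\tilde y_j)$, $[[y_i,\tilde y_j],y_k]=-\langle\lambda,\lambda\rangle\delta_{jk}y_i$, $[[y_i,\tilde y_j],\tilde y_k]=\langle\lambda,\lambda\rangle\delta_{ik}\tilde y_j$; (iv) $[[y_i,y_j],z_k]=[[\tilde y_i,\tilde y_j],\tilde z_k]=0$, $[[y_i,y_j],\tilde z_k]=\langle\lambda,\lambda\rangle(\delta_{jk}z_i+\delta_{ik}z_j)$, $[[\tilde y_i,\tilde y_j],z_k]=-\langle\lambda,\lambda\rangle(\delta_{jk}\tilde z_i+\delta_{ik}\tilde z_j)$, $[[y_i,\tilde y_j],z_k]=-\langle\lambda,\lambda\rangle\delta_{jk}z_i$, $[[y_i,\tilde y_j],\tilde z_k]=\langle\lambda,\lambda\rangle\delta_{ik}\tilde z_j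$.
   Context: Setting: $(\mathfrak g,\mathfrak k,\theta)$ a reductive symmetric superpair of even type ($\mathfrak g$ finite-dimensional complex Lie superalgebra, $\theta$ even involution with $(+1)$-eigenspace $\mathfrak k$ and $(-1)$-eigenspace $\mathfrak p$, $\mathfrak g$ semisimple as $\mathfrak g_0$-module, $\mathfrak z(\mathfrak g)\subset\mathfrak g_0$, $b$ a fixed non-degenerate even supersymmetric $\mathfrak g$- and $\theta$-invariant bilinear form), with even Cartan subspace $\mathfrak a$ ($\mathfrak a\subset\mathfrak p_0$, $\mathfrak a=\mathfrak z_{\mathfrak p}(\mathfrak a)$, $\operatorname{ad}\mathfrak a|_{\mathfrak g_0}$ semisimple). $\mathfrak g^\lambda_j$ denotes the $\lambda$-weight space of $\mathfrak a$ in $\mathfrak g_j$, $\Sigma_j$ the nonzero weights in $\mathfrak g_j$, $m_{\lambda,1}=\dim\mathfrak g_1^\lambda$. $b|_{\mathfrak a}$ is non-degenerate; $A_\lambda\in\mathfrak a$ is defined by $b(A_\lambda,h)=\lambda(h)$ for $h\in\mathfrak a$, and $\langle\lambda,\lambda\rangle=b(A_\lambda,A_\lambda)$. Let $\lambda\in\bar\Sigma_1=\{\lambda\in\Sigma_1:2\lambda\notin\Sigma_0\}$. Known facts: $m_{\lambda,1}=2q$ is even and $b^\theta(x,y)=b(x,\theta y)$ is a symplectic form on $\mathfrak g_1^\lambda$. Let $x_1,\dots,x_q,\tilde x_1,\dots,\tilde x_q$ be a basis of $\mathfrak g_1^\lambda$ with $b^\theta(x_i,x_j)=b^\theta(\tilde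 x_i,\tilde x_j)=0$, $b^\theta(x_i,\tilde x_j)=2\delta_{ij}$, and write $x_j=y_j+z_j$, $\tilde x_j=\tilde y_j+\tilde z_j$ with $y_j,\tilde y_j\in\mathfrak k$, $z_j,\tilde z_j\in\mathfrak p$. (Then $[h,y_i]=\lambda(h)z_i$, $[h,z_i]=\lambda(h)y_i$ etc. for $h\in\mathfrak a$, and $b(y_i,\tilde y_j)=b(\tilde z_j,z_i)=\delta_{ij}$.) *)

theory Defs
  imports "HOL-Analysis.Analysis"
begin

text \<open>Model: the finite-dimensional complex Lie superalgebra g is the space complex^'n
  (every finite-dimensional complex vector space is of this form), with complex scalar
  multiplication (*s).  The Z/2-grading is g = g0 (+) g1.  Parities are natural numbers
  0 / 1; grd g0 g1 i is the homogeneous component of parity i (mod 2).\<close>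

type_synonym 'n cvec = "complex ^ 'n"

definition grd :: "'n::finite cvec set \<Rightarrow> 'n::finite cvec set \<Rightarrow> nat \<Rightarrow> 'n::finite cvec set" where
  "grd g0 g1 i = (if even i then g0 else g1)"

definition kron :: "nat \<Rightarrow> nat \<Rightarrow> complex" where
  "kron i j = (if i = j then 1 else 0)"

text \<open>Lie superalgebra: bilinear graded bracket, super skew-symmetry, super Jacobi.\<close>
definition lie_superalgebra ::
  "('n::finite cvec \<Rightarrow> 'n::finite cvec \<Rightarrow> 'n::finite cvec) \<Rightarrow> 'n::finite cvec set \<Rightarrow> 'n::finite cvec set \<Rightarrow> bool" where
  "lie_superalgebra br g0 g1 \<longleftrightarrow>
     vec.subspace g0 \<and> vec.subspace g1 \<and> g0 \<inter> g1 = {0} \<and>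
     (\<forall>v. \<exists>u\<in>g0. \<exists>w\<in>g1. v = u + w) \<and>
     (\<forall>x. Vector_Spaces.linear (*s) (*s) (br x)) \<and>
     (\<forall>y. Vector_Spaces.linear (*s) (*s) (\<lambda>x. br x y)) \<and>
     (\<forall>i j x y. i < 2 \<and> j < 2 \<and> x \<in> grd g0 g1 i \<and> y \<in> grd g0 g1 j \<longrightarrow>
        br x y \<in> grd g0 g1 (i + j) \<and>
        br x y = - (((-1) ^ (i * j)) *s br y x)) \<and>
     (\<forall>i j x y w. i < 2 \<and> j < 2 \<and> x \<in> grd g0 g1 i \<and> y \<in> grd g0 g1 j \<longrightarrow>
        br x (br y w) = br (br x y) w + ((-1) ^ (i * j)) *s br y (br x w))"

text \<open>Centre of the Lie superalgebra.\<close>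
definition centre :: "('n::finite cvec \<Rightarrow> 'n::finite cvec \<Rightarrow> 'n::finite cvec) \<Rightarrow> 'n::finite cvec set" where
  "centre br = {x. \<forall>y. br x y = 0}"

text \<open>g is semisimple as a g0-module: every g0-submodule has a g0-stable complement.\<close>
definition g0_submodule ::
  "('n::finite cvec \<Rightarrow> 'n::finite cvec \<Rightarrow> 'n::finite cvec) \<Rightarrow> 'n::finite cvec set \<Rightarrow> 'n::finite cvec set \<Rightarrow> bool" where
  "g0_submodule br g0 V \<longleftrightarrow> vec.subspace V \<and> (\<forall>u\<in>g0. \<forall>v\<in>V. br u v \<in> V)"

definition semisimple_g0_module ::
  "('n::finite cvec \<Rightarrow> 'n::finite cvec \<Rightarrow> 'n::finite cvec) \<Rightarrow> 'n::finite cvec set \<Rightarrow> bool" where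
  "semisimple_g0_module br g0 \<longleftrightarrow>
     (\<forall>V. g0_submodule br g0 V \<longrightarrow>
        (\<exists>W. g0_submodule br g0 W \<and> V \<inter> W = {0} \<and> (\<forall>v. \<exists>a\<in>V. \<exists>c\<in>W. v = a + c)))"

text \<open>Reductive symmetric superpair of even type (g,k,theta) with form b.\<close>
definition reductive_symmetric_superpair ::
  "('n::finite cvec \<Rightarrow> 'n::finite cvec \<Rightarrow> 'n::finite cvec) \<Rightarrow> 'n::finite cvec set \<Rightarrow> 'n::finite cvec set \<Rightarrow>
   ('n::finite cvec \<Rightarrow> 'n::finite cvec) \<Rightarrow> ('n::finite cvec \<Rightarrow> 'n::finite cvec \<Rightarrow> complex) \<Rightarrow> bool" where
  "reductive_symmetric_superpair br g0 g1 \<theta> b \<longleftrightarrow>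
     lie_superalgebra br g0 g1 \<and>
     \<comment> \<open>theta is an even involutive automorphism\<close>
     Vector_Spaces.linear (*s) (*s) \<theta> \<and>
     (\<forall>x. \<theta> (\<theta> x) = x) \<and>
     (\<forall>x y. \<theta> (br x y) = br (\<theta> x) (\<theta> y)) \<and>
     \<theta> ` g0 \<subseteq> g0 \<and> \<theta> ` g1 \<subseteq> g1 \<and>
     \<comment> \<open>g semisimple as g0-module, centre contained in g0\<close>
     semisimple_g0_module br g0 \<and>
     centre br \<subseteq> g0 \<and>
     \<comment> \<open>b: bilinear, non-degenerate, even, supersymmetric, invariant, theta-invariant\<close>
     (\<forall>x. Vector_Spaces.linear (*s) (*) (b x)) \<and>
     (\<forall>y. Vector_Spaces.linear (*s) (*) (\<lambda>x. b x y)) \<and>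
     (\<forall>x. (\<forall>y. b x y = 0) \<longrightarrow> x = 0) \<and>
     (\<forall>x\<in>g0. \<forall>y\<in>g1. b x y = 0 \<and> b y x = 0) \<and>
     (\<forall>i j x y. i < 2 \<and> j < 2 \<and> x \<in> grd g0 g1 i \<and> y \<in> grd g0 g1 j \<longrightarrow>
        b x y = (-1) ^ (i * j) * b y x) \<and>
     (\<forall>x y z. b (br x y) z = b x (br y z)) \<and>
     (\<forall>x y. b (\<theta> x) (\<theta> y) = b x y)"

definition kpart :: "('n::finite cvec \<Rightarrow> 'n::finite cvec) \<Rightarrow> 'n::finite cvec set" where
  "kpart \<theta> = {x. \<theta> x = x}"

definition ppart :: "('n::finite cvec \<Rightarrow> 'n::finite cvec) \<Rightarrow> 'n::finite cvec set" where
  "ppart \<theta> = {x. \<theta> x = - x}"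

text \<open>Even Cartan subspace a: a subset of p0, equal to its centraliser in p,
  and ad h restricted to g0 semisimple (diagonalisable) for every h in a.\<close>
definition even_cartan_subspace ::
  "('n::finite cvec \<Rightarrow> 'n::finite cvec \<Rightarrow> 'n::finite cvec) \<Rightarrow> 'n::finite cvec set \<Rightarrow> ('n::finite cvec \<Rightarrow> 'n::finite cvec) \<Rightarrow>
   'n::finite cvec set \<Rightarrow> bool" where
  "even_cartan_subspace br g0 \<theta> a \<longleftrightarrow>
     vec.subspace a \<and> a \<subseteq> ppart \<theta> \<inter> g0 \<and>
     a = {x \<in> ppart \<theta>. \<forall>h\<in>a. br x h = 0} \<and>
     (\<forall>h\<in>a. vec.span {x \<in> g0. \<exists>c. br h x = c *s x} = g0)"

text \<open>Weight space of lambda (a functional, only its values on a matter) in V.\<close>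
definition wspace ::
  "('n::finite cvec \<Rightarrow> 'n::finite cvec \<Rightarrow> 'n::finite cvec) \<Rightarrow> 'n::finite cvec set \<Rightarrow> 'n::finite cvec set \<Rightarrow>
   ('n::finite cvec \<Rightarrow> complex) \<Rightarrow> 'n::finite cvec set" where
  "wspace br a V lam = {x \<in> V. \<forall>h\<in>a. br h x = lam h *s x}"

text \<open>lambda is a root in V: a nonzero weight (on a) with nonzero weight space.\<close>
definition is_root ::
  "('n::finite cvec \<Rightarrow> 'n::finite cvec \<Rightarrow> 'n::finite cvec) \<Rightarrow> 'n::finite cvec set \<Rightarrow> 'n::finite cvec set \<Rightarrow>
   ('n::finite cvec \<Rightarrow> complex) \<Rightarrow> bool" where
  "is_root br a V lam \<longleftrightarrow> (\<exists>h\<in>a. lam h \<noteq> 0) \<and> wspace br a V lam \<noteq> {0}"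

end

theory Submission
  imports Defs
begin

text \<open>
  Proof idea.  Write Y u = kproj u, Z u = pproj u for the k- and p-components of u in
  g = k (+) p, so that y_i = Y x_i, z_i = Z x_i etc.  For u in the
  lambda-weight space W of g1, ad h (h in a) interchanges Y u and Z u with factor lambda(h),
  and since 2 lambda is not a root, [W, W] = 0.  Expanding [u, v] = 0 into components gives
  part (ii).  Part (i): [Y u, Z v] lies in p0 and, by (ii), centralises a, so it lies in a;
  its pairing with h in a is lambda(h) times -b(u, theta v)/2, so by non-degeneracy of b on a
  it equals -b(u, theta v)/2 A_lambda.  Part (iv) follows from (i) by the odd Jacobi identity,
  and part (iii) by applying ad h0 with lambda(h0) ~= 0 to (iv), using that [Y u, Y v]
  centralises a.  Finally, the symplectic normalisation of the basis evaluates b(u, theta v).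
\<close>

text \<open>Any vector in the span of eigenvectors of a linear map T splits into a vector of
  ker T and finitely many eigenvectors with nonzero eigenvalues.\<close>
lemma eigenvector_sum:
  fixes T :: "'n::finite cvec \<Rightarrow> 'n cvec"
  assumes T: "Vector_Spaces.linear (*s) (*s) T"
    and v: "v \<in> vec.span E" and E: "\<forall>x\<in>E. \<exists>c. T x = c *s x"
  shows "\<exists>v0 (n::nat) e c. T v0 = 0 \<and> (\<forall>t<n. T (e t) = c t *s e t \<and> c t \<noteq> 0) \<and>
           v = v0 + (\<Sum>t<n. e t)"
  using v
proof (induction rule: vec.span_induct_alt)
  case base
  have "T 0 = 0" using vec.linear_0[OF T] .
  then show ?case by (intro exI[of _ 0] exI[of _ "0::nat"]) simp
next
  case (step d x y)
  obtain cx where cx: "T x = cx *s x" using E step(1) by blast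
  obtain v0 and n :: nat and e c where IH: "T v0 = 0" "\<forall>t<n. T (e t) = c t *s e t \<and> c t \<noteq> 0"
    "y = v0 + (\<Sum>t<n. e t)" using step(2) by blast
  show ?case
  proof (cases "cx = 0")
    case True
    then have "T (d *s x + v0) = 0" using IH(1) cx by (simp add: vec.linear_add[OF T] vec.linear_scale[OF T])
    moreover have "d *s x + y = (d *s x + v0) + (\<Sum>t<n. e t)" using IH(3) by (simp add: add.assoc)
    ultimately show ?thesis using IH(2) by blast
  next
    case False
    let ?e = "e(n := d *s x)" and ?c = "c(n := cx)"
    have "\<forall>t<Suc n. T (?e t) = ?c t *s ?e t \<and> ?c t \<noteq> 0"
      using IH(2) False cx
      by (auto simp: vec.linear_scale[OF T] vector_smult_assoc mult.commute less_Suc_eq)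
    moreover have "d *s x + y = v0 + (\<Sum>t<Suc n. ?e t)" using IH(3) by (simp add: algebra_simps)
    ultimately show ?thesis using IH(1) by blast
  qed
qed

text \<open>Consequences of the Lie superalgebra axioms.\<close>
locale lie_superalg =
  fixes br :: "'n::finite cvec \<Rightarrow> 'n cvec \<Rightarrow> 'n cvec"
    and g0 g1 :: "'n cvec set"
  assumes lie: "lie_superalgebra br g0 g1"
begin

lemma subspace_g0: "vec.subspace g0" and subspace_g1: "vec.subspace g1"
  and parity_decomposition: "\<exists>u\<in>g0. \<exists>w\<in>g1. v = u + w"
  and linear_left: "Vector_Spaces.linear (*s) (*s) (\<lambda>x. br x y)"
  and linear_right: "Vector_Spaces.linear (*s) (*s) (br x)"
  using lie unfolding lie_superalgebra_def by blast+

lemmas bracket_linear[simp] =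
  vec.linear_add[OF linear_left] vec.linear_scale[OF linear_left] vec.linear_neg[OF linear_left]
  vec.linear_diff[OF linear_left] vec.linear_0[OF linear_left]
  vec.linear_add[OF linear_right] vec.linear_scale[OF linear_right] vec.linear_neg[OF linear_right]
  vec.linear_diff[OF linear_right] vec.linear_0[OF linear_right]

text \<open>The grading, super skew-symmetry and super Jacobi axioms for homogeneous elements.\<close>
lemma graded:
  assumes "i < 2" "j < 2" "u \<in> grd g0 g1 i" "v \<in> grd g0 g1 j"
  shows "br u v \<in> grd g0 g1 (i + j)" "br u v = - (((-1) ^ (i * j)) *s br v u)"
    "br u (br v w) = br (br u v) w + ((-1) ^ (i * j)) *s br v (br u w)"
  using lie assms unfolding lie_superalgebra_def by blast+

lemma even_bracket: "u \<in> g0 \<Longrightarrow> v \<in> g0 \<Longrightarrow> br u v \<in> g0"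
  using graded(1)[of 0 0 u v] by (simp add: grd_def)

lemma odd_bracket: "u \<in> g1 \<Longrightarrow> v \<in> g1 \<Longrightarrow> br u v \<in> g0"
  using graded(1)[of 1 1 u v] by (simp add: grd_def)

lemma odd_symmetric: "u \<in> g1 \<Longrightarrow> v \<in> g1 \<Longrightarrow> br u v = br v u"
  using graded(2)[of 1 1 u v] by (simp add: grd_def)

lemma odd_jacobi: "u \<in> g1 \<Longrightarrow> v \<in> g1 \<Longrightarrow> br u (br v w) = br (br u v) w - br v (br u w)"
  using graded(3)[of 1 1 u v w] by (simp add: grd_def)

text \<open>Even elements skew-commute and act by derivations on all of g (not only on homogeneous
  elements), by splitting the second argument into its homogeneous parts.\<close>
lemma even_skew:
  assumes u: "u \<in> g0"
  shows "br u v = - br v u"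
proof -
  obtain v0 v1 where v: "v0 \<in> g0" "v1 \<in> g1" "v = v0 + v1" using parity_decomposition by blast
  have "br u v0 = - br v0 u" using graded(2)[of 0 0 u v0] u v by (simp add: grd_def)
  moreover have "br u v1 = - br v1 u" using graded(2)[of 0 1 u v1] u v by (simp add: grd_def)
  ultimately show ?thesis using v(3) by simp
qed

lemma even_jacobi:
  assumes u: "u \<in> g0"
  shows "br u (br v w) = br (br u v) w + br v (br u w)"
proof -
  obtain v0 v1 where v: "v0 \<in> g0" "v1 \<in> g1" "v = v0 + v1" using parity_decomposition by blast
  have "br u (br v0 w) = br (br u v0) w + br v0 (br u w)"
    using graded(3)[of 0 0 u v0] u v by (simp add: grd_def)
  moreover have "br u (br v1 w) = br (br u v1) w + br v1 (br u w)"
    using graded(3)[of 0 1 u v1] u v by (simp add: grd_def)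
  ultimately show ?thesis using v(3) by simp
qed

end

text \<open>Linearity rules for linear functionals on the model space.\<close>
lemma functional_linear:
  fixes f :: "'n::finite cvec \<Rightarrow> complex"
  assumes f: "Vector_Spaces.linear (*s) (*) f"
  shows "f (x + y) = f x + f y" "f (c *s x) = c * f x" "f (- x) = - f x"
    "f (x - y) = f x - f y" "f 0 = 0"
  using f by (metis module_hom.add module_hom.scale module_hom.neg module_hom.diff module_hom.zero
      module_hom_iff_linear)+

text \<open>The involution theta and the invariant form b of a reductive symmetric superpair.\<close>
locale symmetric_superpair =
  fixes br :: "'n::finite cvec \<Rightarrow> 'n cvec \<Rightarrow> 'n cvec"
    and g0 g1 :: "'n cvec set"
    and \<theta> :: "'n cvec \<Rightarrow> 'n cvec"
    and b :: "'n cvec \<Rightarrow> 'n cvec \<Rightarrow> complex"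
  assumes pair: "reductive_symmetric_superpair br g0 g1 \<theta> b"
begin

sublocale lie_superalg br g0 g1
  using pair unfolding reductive_symmetric_superpair_def by unfold_locales blast

lemma theta_linear: "Vector_Spaces.linear (*s) (*s) \<theta>"
  and theta_involutive[simp]: "\<theta> (\<theta> x) = x"
  and theta_bracket: "\<theta> (br x y) = br (\<theta> x) (\<theta> y)"
  and theta_g0: "x \<in> g0 \<Longrightarrow> \<theta> x \<in> g0"
  and theta_g1: "x \<in> g1 \<Longrightarrow> \<theta> x \<in> g1"
  and form_linear_right: "Vector_Spaces.linear (*s) (*) (b x)"
  and form_linear_left: "Vector_Spaces.linear (*s) (*) (\<lambda>x. b x y)"
  and form_nondegenerate: "(\<forall>y. b x y = 0) \<Longrightarrow> x = 0"
  and form_even: "x \<in> g0 \<Longrightarrow> y \<in> g1 \<Longrightarrow> b x y = 0"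
  and form_invariant: "b (br x y) z = b x (br y z)"
  and form_theta: "b (\<theta> x) (\<theta> y) = b x y"
  using pair unfolding reductive_symmetric_superpair_def by (auto simp: image_subset_iff)

lemmas theta_lin[simp] =
  vec.linear_add[OF theta_linear] vec.linear_scale[OF theta_linear] vec.linear_neg[OF theta_linear]
  vec.linear_diff[OF theta_linear] vec.linear_0[OF theta_linear]

lemmas form_lin[simp] = functional_linear[OF form_linear_left] functional_linear[OF form_linear_right]

text \<open>Supersymmetry of the form on homogeneous elements.\<close>
lemma form_symmetric_even: "x \<in> g0 \<Longrightarrow> y \<in> g0 \<Longrightarrow> b x y = b y x"
  and form_skew_odd: "x \<in> g1 \<Longrightarrow> y \<in> g1 \<Longrightarrow> b x y = - b y x"
proof -
  have sym: "\<forall>i j x y. i < 2 \<and> j < 2 \<and> x \<in> grd g0 g1 i \<and> y \<in> grd g0 g1 j \<longrightarrow>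
          b x y = (-1) ^ (i * j) * b y x"
    using pair unfolding reductive_symmetric_superpair_def by blast
  show "x \<in> g0 \<Longrightarrow> y \<in> g0 \<Longrightarrow> b x y = b y x"
    using sym[rule_format, of 0 0 x y] by (simp add: grd_def)
  show "x \<in> g1 \<Longrightarrow> y \<in> g1 \<Longrightarrow> b x y = - b y x"
    using sym[rule_format, of 1 1 x y] by (simp add: grd_def)
qed

lemma form_theta_swap: "b (\<theta> u) v = b u (\<theta> v)"
  using form_theta[of "\<theta> u" v] by simp

text \<open>The projections of g = k (+) p onto the (+1)- and (-1)-eigenspaces of theta.\<close>
definition kproj :: "'n cvec \<Rightarrow> 'n cvec" where
  "kproj u = (1/2::complex) *s (u + \<theta> u)"

definition pproj :: "'n cvec \<Rightarrow> 'n cvec" where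
  "pproj u = (1/2::complex) *s (u - \<theta> u)"

lemma theta_kproj[simp]: "\<theta> (kproj u) = kproj u"
  and theta_pproj[simp]: "\<theta> (pproj u) = - pproj u"
  and kproj_plus_pproj: "kproj u + pproj u = u"
  unfolding kproj_def pproj_def by (simp_all add: vec_eq_iff field_simps)

lemma projections_of_decomposition:
  assumes "\<theta> y = y" "\<theta> z = - z"
  shows "kproj (y + z) = y" "pproj (y + z) = z"
  unfolding kproj_def pproj_def using assms by (simp_all add: vec_eq_iff field_simps)

text \<open>k and p are b-orthogonal, by theta-invariance of b.\<close>
lemma form_p_k_orthogonal:
  assumes "\<theta> z = - z" "\<theta> y = y"
  shows "b z y = 0"
  using form_theta[of z y] assms by simp

end

text \<open>An even Cartan subspace a: a maximal abelian subspace of p0 whose elements act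
  diagonalisably on g0.\<close>
locale cartan_pair = symmetric_superpair br g0 g1 \<theta> b
  for br :: "'n::finite cvec \<Rightarrow> 'n cvec \<Rightarrow> 'n cvec" and g0 g1 \<theta> b +
  fixes a :: "'n cvec set"
  assumes cartan: "even_cartan_subspace br g0 \<theta> a"
begin

lemma a_subspace: "vec.subspace a"
  and a_maximal_abelian: "a = {x \<in> ppart \<theta>. \<forall>h\<in>a. br x h = 0}"
  and a_diagonalizable: "h \<in> a \<Longrightarrow> vec.span {x \<in> g0. \<exists>c. br h x = c *s x} = g0"
  and a_g0: "h \<in> a \<Longrightarrow> h \<in> g0"
  and theta_a: "h \<in> a \<Longrightarrow> \<theta> h = - h"
  using cartan unfolding even_cartan_subspace_def ppart_def by blast+

lemma a_abelian: "h \<in> a \<Longrightarrow> k \<in> a \<Longrightarrow> br h k = 0"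
  using a_maximal_abelian by blast

text \<open>a is its own centraliser in p0.\<close>
lemma a_self_centralizing:
  assumes "\<theta> w = - w" "w \<in> g0" "\<forall>h\<in>a. br h w = 0"
  shows "w \<in> a"
proof -
  have "\<forall>h\<in>a. br w h = 0" using assms even_skew[of w] by fastforce
  then show ?thesis using assms a_maximal_abelian unfolding ppart_def by blast
qed

text \<open>Non-degeneracy of b on a.  For w in a orthogonal to a we show, removing the elements
  of a basis of a one at a time, that w is orthogonal to the centraliser of ever smaller
  subsets of a, ending with all of g0; then w = 0 by non-degeneracy of b on g.\<close>

text \<open>w is b-orthogonal to the centraliser of S in g0.\<close>
definition perp_centralizer :: "'n cvec \<Rightarrow> 'n cvec set \<Rightarrow> bool" where
  "perp_centralizer w S \<longleftrightarrow> (\<forall>u\<in>g0. (\<forall>k\<in>S. br k u = 0) \<longrightarrow> b w u = 0)"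

text \<open>Elements of a are orthogonal to the image of ad h for h in a, by invariance of b.\<close>
lemma form_a_image: "w \<in> a \<Longrightarrow> h \<in> a \<Longrightarrow> b w (br h u) = 0"
  using form_invariant[of w h u] a_abelian[of w h] by simp

text \<open>If w in a is orthogonal to a, it is orthogonal to the centraliser of a in g0:
  the k-part of such an element is orthogonal to p, its p-part lies in a.\<close>
lemma perp_centralizer_a:
  assumes w: "w \<in> a" and w_perp: "\<forall>h\<in>a. b h w = 0"
  shows "perp_centralizer w a"
  unfolding perp_centralizer_def
proof (intro ballI impI)
  fix u assume u: "u \<in> g0" and u_cent: "\<forall>h\<in>a. br h u = 0"
  have "b w (kproj u) = 0"
    using form_p_k_orthogonal[OF theta_a[OF w] theta_kproj] .
  have "br h (pproj u) = 0" if h: "h \<in> a" for h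
  proof -
    have "\<theta> (br h (\<theta> u)) = 0" using theta_a[OF h] u_cent h by (simp add: theta_bracket)
    then have "br h (\<theta> u) = 0" using theta_involutive[of "br h (\<theta> u)"] by simp
    then show ?thesis unfolding pproj_def using u_cent h by simp
  qed
  moreover have "pproj u \<in> g0"
    unfolding pproj_def using u theta_g0 subspace_g0 by (simp add: vec.subspace_diff vec.subspace_scale)
  ultimately have "pproj u \<in> a" using a_self_centralizing theta_pproj by blast
  then have "b w (pproj u) = 0"
    using form_symmetric_even[OF a_g0[OF w]] w_perp a_g0 by metis
  then show "b w u = 0"
    using \<open>b w (kproj u) = 0\<close> kproj_plus_pproj[of u] form_lin(6)[of w "kproj u" "pproj u"] by simp
qed


text \<open>Descent along one h in a.  Let v in g0 centralise S and decompose into ad h-eigenvectors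
  as v = v0 + e_0 + ... + e_(n-1) with [h,v0] = 0 and eigenvalues c_t ~= 0.  If w is orthogonal
  to the centraliser of insert h S then b w v = 0: induct on n, replacing v by [h,v] - c_n v,
  which kills the last eigencomponent and satisfies b w ([h,v] - c_n v) = - c_n b w v.\<close>
lemma perp_eigen_sum:
  fixes n :: nat
  assumes h: "h \<in> a" and S: "S \<subseteq> a" and w: "w \<in> a"
    and perp: "perp_centralizer w (insert h S)"
  shows "v \<in> g0 \<Longrightarrow> \<forall>k\<in>S. br k v = 0 \<Longrightarrow> br h v0 = 0 \<Longrightarrow>
    \<forall>t<n. br h (e t) = c t *s e t \<and> c t \<noteq> 0 \<Longrightarrow> v = v0 + (\<Sum>t<n. e t) \<Longrightarrow> b w v = 0"
proof (induction n arbitrary: v v0 e)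
  case 0
  then show ?case using perp unfolding perp_centralizer_def by simp
next
  case (Suc n)
  define v' where "v' = br h v - c n *s v"
  have "br h v = (\<Sum>t<Suc n. c t *s e t)"
    using Suc.prems(3-5) by (simp add: vec.linear_sum[OF linear_right])
  then have v'_eq: "v' = (- c n) *s v0 + (\<Sum>t<n. (c t - c n) *s e t)"
    unfolding v'_def using Suc.prems(5)
    by (simp add: vector_sub_rdistrib sum_subtractf vec.scale_sum_right vector_add_ldistrib algebra_simps)
  have "v' \<in> g0"
    unfolding v'_def using Suc.prems(1) even_bracket[OF a_g0[OF h]] subspace_g0
    by (simp add: vec.subspace_diff vec.subspace_scale)
  moreover have "br k v' = 0" if k: "k \<in> S" for k
  proof -
    have "br k (br h v) = br (br k h) v + br h (br k v)" using even_jacobi[OF a_g0] k S by blast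
    then show ?thesis unfolding v'_def using a_abelian[of k h] k S h Suc.prems(2) by auto
  qed
  moreover have "\<forall>t<n. br h ((c t - c n) *s e t) = c t *s ((c t - c n) *s e t) \<and> c t \<noteq> 0"
    using Suc.prems(4) by (simp add: vector_smult_assoc mult.commute)
  ultimately have "b w v' = 0"
    using Suc.IH[of v' "(- c n) *s v0"] Suc.prems(3) v'_eq by simp
  moreover have "b w v' = - c n * b w v"
    unfolding v'_def using form_a_image[OF w h] by simp
  ultimately show ?case using Suc.prems(4) by simp
qed

text \<open>Hence orthogonality to a centraliser survives removing one generator of a.\<close>
lemma perp_centralizer_remove:
  assumes h: "h \<in> a" and S: "S \<subseteq> a" and w: "w \<in> a"
    and perp: "perp_centralizer w (insert h S)"
  shows "perp_centralizer w S"
  unfolding perp_centralizer_def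
proof (intro ballI impI)
  fix u assume u: "u \<in> g0" and u_cent: "\<forall>k\<in>S. br k u = 0"
  have "u \<in> vec.span {x \<in> g0. \<exists>c. br h x = c *s x}"
    using a_diagonalizable[OF h] u by simp
  moreover have "\<forall>x\<in>{x \<in> g0. \<exists>c. br h x = c *s x}. \<exists>c. br h x = c *s x" by blast
  ultimately have "\<exists>v0 (n::nat) e c. br h v0 = 0 \<and> (\<forall>t<n. br h (e t) = c t *s e t \<and> c t \<noteq> 0) \<and>
      u = v0 + (\<Sum>t<n. e t)"
    by (rule eigenvector_sum[OF linear_right])
  then obtain v0 and n :: nat and e c where
    "br h v0 = 0" "\<forall>t<n. br h (e t) = c t *s e t \<and> c t \<noteq> 0" "u = v0 + (\<Sum>t<n. e t)"
    by blast
  from perp_eigen_sum[OF h S w perp u u_cent this] show "b w u = 0" .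
qed

text \<open>Iterating, a finite subset of a can be removed.\<close>
lemma perp_centralizer_remove_finite:
  assumes "finite T"
  shows "T \<subseteq> a \<Longrightarrow> S \<subseteq> a \<Longrightarrow> w \<in> a \<Longrightarrow> perp_centralizer w (T \<union> S) \<Longrightarrow>
    perp_centralizer w S"
  using assms
proof (induction T arbitrary: S rule: finite_induct)
  case (insert h T)
  have "insert h T \<union> S = T \<union> insert h S" by blast
  then have "perp_centralizer w (insert h S)"
    using insert.IH[of "insert h S"] insert.prems by simp
  then show ?case using perp_centralizer_remove[of h S w] insert.prems by simp
qed simp

text \<open>The restriction of b to a is non-degenerate.\<close>
theorem form_nondegenerate_on_a:
  assumes w: "w \<in> a" and w_perp: "\<forall>h\<in>a. b h w = 0"
  shows "w = 0"
proof -
  obtain B where B: "B \<subseteq> a" "vec.independent B" "a \<subseteq> vec.span B"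
    using vec.basis_exists[of a] by metis
  have "perp_centralizer w B"
    unfolding perp_centralizer_def
  proof (intro ballI impI)
    fix u assume u: "u \<in> g0" and u_cent: "\<forall>k\<in>B. br k u = 0"
    have "br k u = 0" if "k \<in> vec.span B" for k
      using that by (induction rule: vec.span_induct_alt) (simp_all add: u_cent)
    then have "\<forall>h\<in>a. br h u = 0" using B(3) by auto
    with u show "b w u = 0"
      using perp_centralizer_a[OF w w_perp] unfolding perp_centralizer_def by simp
  qed
  then have "perp_centralizer w {}"
    using perp_centralizer_remove_finite[OF vec.finiteI_independent[OF B(2)] B(1), of "{}"] w
    by simp
  then have even: "b w u = 0" if "u \<in> g0" for u using that unfolding perp_centralizer_def by simp
  have "b w v = 0" for v
  proof -
    obtain v0 v1 where "v0 \<in> g0" "v1 \<in> g1" "v = v0 + v1" using parity_decomposition by blast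
    then show ?thesis using even form_even[OF a_g0[OF w]] by simp
  qed
  then show ?thesis by (rule form_nondegenerate[rule_format])
qed

end

text \<open>A root lambda in g1 with 2 lambda not a root in g0, and its dual vector A in a.\<close>
locale root_setting = cartan_pair br g0 g1 \<theta> b a
  for br :: "'n::finite cvec \<Rightarrow> 'n cvec \<Rightarrow> 'n cvec" and g0 g1 \<theta> b a +
  fixes lam :: "'n cvec \<Rightarrow> complex" and A :: "'n cvec"
  assumes root1: "is_root br a g1 lam"
    and not_root0: "\<not> is_root br a g0 (\<lambda>h. 2 * lam h)"
    and A_mem: "A \<in> a"
    and A_dual: "\<forall>h\<in>a. b A h = lam h"
begin

text \<open>W is the lambda-weight space in g1.\<close>
abbreviation W :: "'n cvec set" where
  "W \<equiv> wspace br a g1 lam"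

lemma W_g1: "u \<in> W \<Longrightarrow> u \<in> g1"
  and W_weight: "u \<in> W \<Longrightarrow> h \<in> a \<Longrightarrow> br h u = lam h *s u"
  unfolding wspace_def by blast+

text \<open>lambda is a nonzero functional on a.\<close>
lemma lam_nonzero: obtains h0 where "h0 \<in> a" "lam h0 \<noteq> 0"
  using root1 unfolding is_root_def by blast

text \<open>Since 2 lambda is not a root in g0, brackets of two lambda-weight vectors vanish.\<close>
lemma W_bracket_zero:
  assumes u: "u \<in> W" and v: "v \<in> W"
  shows "br u v = 0"
proof -
  have "br h (br u v) = (2 * lam h) *s br u v" if h: "h \<in> a" for h
    using even_jacobi[OF a_g0[OF h], of u v] W_weight[OF u h] W_weight[OF v h]
    by (simp add: vec_eq_iff algebra_simps)
  then have "br u v \<in> wspace br a g0 (\<lambda>h. 2 * lam h)"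
    unfolding wspace_def using odd_bracket[OF W_g1[OF u] W_g1[OF v]] by blast
  moreover have "\<exists>h\<in>a. 2 * lam h \<noteq> 0" using lam_nonzero by force
  ultimately show ?thesis using not_root0 unfolding is_root_def by blast
qed

text \<open>Likewise b vanishes on W x W, by invariance: lambda(h0) b(u, v) = b(h0, [u, v]).\<close>
lemma W_form_zero:
  assumes u: "u \<in> W" and v: "v \<in> W"
  shows "b u v = 0"
proof -
  obtain h0 where h0: "h0 \<in> a" "lam h0 \<noteq> 0" using lam_nonzero .
  have "lam h0 * b u v = b h0 (br u v)"
    using form_invariant[of h0 u v] W_weight[OF u h0(1)] by simp
  then show ?thesis using W_bracket_zero[OF u v] h0(2) by simp
qed

text \<open>theta maps the lambda-weight space to the (-lambda)-weight space.\<close>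
lemma theta_W_weight:
  assumes u: "u \<in> W" and h: "h \<in> a"
  shows "br h (\<theta> u) = (- lam h) *s \<theta> u"
proof -
  have "\<theta> (br h (\<theta> u)) = (- lam h) *s u"
    using theta_a[OF h] W_weight[OF u h] by (simp add: theta_bracket)
  then show ?thesis using theta_involutive[of "br h (\<theta> u)"] by simp
qed

text \<open>ad h interchanges the k- and p-parts of a lambda-weight vector.\<close>
lemma kproj_weight: "u \<in> W \<Longrightarrow> h \<in> a \<Longrightarrow> br h (kproj u) = lam h *s pproj u"
  and pproj_weight: "u \<in> W \<Longrightarrow> h \<in> a \<Longrightarrow> br h (pproj u) = lam h *s kproj u"
  unfolding kproj_def pproj_def
  by (simp_all add: W_weight theta_W_weight vec_eq_iff algebra_simps)

text \<open>Components of odd vectors are odd.\<close>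
lemma kproj_g1: "u \<in> W \<Longrightarrow> kproj u \<in> g1"
  and pproj_g1: "u \<in> W \<Longrightarrow> pproj u \<in> g1"
  unfolding kproj_def pproj_def using W_g1 theta_g1 subspace_g1
  by (simp_all add: vec.subspace_add vec.subspace_diff vec.subspace_scale)

text \<open>Part (ii): expand [u, v] = 0 and [theta u, theta v] = theta [u, v] = 0 into components.\<close>
lemma bracket_k_k:
  "u \<in> W \<Longrightarrow> v \<in> W \<Longrightarrow> br (kproj u) (kproj v) = - br (pproj u) (pproj v)"
  unfolding kproj_def pproj_def
  by (simp add: W_bracket_zero theta_bracket[symmetric] vec_eq_iff algebra_simps)

text \<open>Pairing of p-components, using b = 0 on W x W.\<close>
lemma form_pproj:
  "u \<in> W \<Longrightarrow> v \<in> W \<Longrightarrow> b (pproj u) (pproj v) = - (1/2) * b u (\<theta> v)"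
  unfolding pproj_def by (simp add: W_form_zero form_theta_swap algebra_simps)

text \<open>A is the b-dual of lambda on a.\<close>
lemma form_a_A: "h \<in> a \<Longrightarrow> b h A = lam h"
  using form_symmetric_even[OF a_g0 a_g0[OF A_mem]] A_dual by simp

text \<open>Part (i): [Y u, Z v] is a multiple of A_lambda.  It lies in p0 and centralises a by
  (ii), hence lies in a; its pairing with a is computed by invariance of b, and
  non-degeneracy of b on a identifies it.\<close>
lemma bracket_k_p:
  assumes u: "u \<in> W" and v: "v \<in> W"
  shows "br (kproj u) (pproj v) = (- (1/2) * b u (\<theta> v)) *s A"
proof -
  define M where "M = br (kproj u) (pproj v)"
  define c where "c = - (1/2) * b u (\<theta> v)"
  have "br h M = 0" if h: "h \<in> a" for h
  proof -
    have "br h M = br (br h (kproj u)) (pproj v) + br (kproj u) (br h (pproj v))"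
      unfolding M_def using even_jacobi[OF a_g0[OF h]] .
    also have "\<dots> = lam h *s (br (pproj u) (pproj v) + br (kproj u) (kproj v))"
      using kproj_weight[OF u h] pproj_weight[OF v h] by (simp add: vector_add_ldistrib)
    finally show ?thesis using bracket_k_k[OF u v] by simp
  qed
  moreover have "M \<in> g0" unfolding M_def using odd_bracket kproj_g1 pproj_g1 u v by blast
  moreover have "\<theta> M = - M" unfolding M_def by (simp add: theta_bracket)
  ultimately have "M \<in> a" using a_self_centralizing by blast
  then have "M - c *s A \<in> a"
    using A_mem a_subspace by (simp add: vec.subspace_diff vec.subspace_scale)
  moreover have "b h (M - c *s A) = 0" if h: "h \<in> a" for h
  proof -
    have "b h M = b (br h (kproj u)) (pproj v)" unfolding M_def by (simp add: form_invariant)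
    also have "\<dots> = lam h * c" using kproj_weight[OF u h] form_pproj[OF u v] by (simp add: c_def)
    finally show ?thesis using form_a_A[OF h] by simp
  qed
  ultimately have "M - c *s A = 0" using form_nondegenerate_on_a by blast
  then show ?thesis unfolding M_def c_def by (rule right_minus_eq[THEN iffD1])
qed

text \<open>Bracket of a k-component with A, from the weight relation with h = A.\<close>
lemma kproj_bracket_A: "u \<in> W \<Longrightarrow> br (kproj u) A = - (b A A *s pproj u)"
  using even_skew[OF a_g0[OF A_mem], of "kproj u"] kproj_weight[OF _ A_mem] A_dual A_mem by simp

text \<open>Part (iv), by the odd Jacobi identity and (i).\<close>
lemma bracket_kk_p:
  assumes u: "u \<in> W" and v: "v \<in> W" and w: "w \<in> W"
  shows "br (br (kproj u) (kproj v)) (pproj w) =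
    (b A A / 2) *s (b v (\<theta> w) *s pproj u + b u (\<theta> w) *s pproj v)"
proof -
  have "br (br (kproj u) (kproj v)) (pproj w) =
      br (kproj u) (br (kproj v) (pproj w)) + br (kproj v) (br (kproj u) (pproj w))"
    using odd_jacobi[OF kproj_g1[OF u] kproj_g1[OF v], of "pproj w"] by (simp add: algebra_simps)
  then show ?thesis
    using bracket_k_p[OF v w] bracket_k_p[OF u w] kproj_bracket_A[OF u] kproj_bracket_A[OF v]
    by (simp add: vec_eq_iff algebra_simps)
qed

text \<open>[Y u, Y v] centralises a: by (i) the two Jacobi terms cancel, as b u (theta v) is
  antisymmetric in u, v.\<close>
lemma kk_centralizes_a:
  assumes u: "u \<in> W" and v: "v \<in> W" and h: "h \<in> a"
  shows "br h (br (kproj u) (kproj v)) = 0"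
proof -
  have "b v (\<theta> u) = - b u (\<theta> v)"
    using form_skew_odd[OF W_g1[OF v] theta_g1[OF W_g1[OF u]]] by (simp add: form_theta_swap)
  then have "br (kproj v) (pproj u) + br (kproj u) (pproj v) = 0"
    using bracket_k_p[OF v u] bracket_k_p[OF u v] by (simp add: vec_eq_iff algebra_simps)
  moreover have "br h (br (kproj u) (kproj v)) =
      lam h *s (br (kproj v) (pproj u) + br (kproj u) (pproj v))"
    using even_jacobi[OF a_g0[OF h], of "kproj u" "kproj v"] kproj_weight[OF u h] kproj_weight[OF v h]
      odd_symmetric[OF pproj_g1[OF u] kproj_g1[OF v]]
    by (simp add: vector_add_ldistrib)
  ultimately show ?thesis by simp
qed

text \<open>Part (iii): apply ad h0 (with lambda(h0) ~= 0) to (iv); since [Y u, Y v] centralises a,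
  this turns the p-parts into k-parts.\<close>
lemma bracket_kk_k:
  assumes u: "u \<in> W" and v: "v \<in> W" and w: "w \<in> W"
  shows "br (br (kproj u) (kproj v)) (kproj w) =
    (b A A / 2) *s (b v (\<theta> w) *s kproj u + b u (\<theta> w) *s kproj v)"
proof -
  obtain h0 where h0: "h0 \<in> a" "lam h0 \<noteq> 0" using lam_nonzero .
  define M where "M = br (kproj u) (kproj v)"
  have "br h0 (br M (pproj w)) = br (br h0 M) (pproj w) + br M (br h0 (pproj w))"
    using even_jacobi[OF a_g0[OF h0(1)]] .
  also have "\<dots> = lam h0 *s br M (kproj w)"
    using kk_centralizes_a[OF u v h0(1)] pproj_weight[OF w h0(1)] unfolding M_def by simp
  finally have "lam h0 *s br M (kproj w) = br h0 (br M (pproj w))" ..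
  also have "\<dots> = lam h0 *s ((b A A / 2) *s (b v (\<theta> w) *s kproj u + b u (\<theta> w) *s kproj v))"
    unfolding M_def bracket_kk_p[OF u v w] using pproj_weight[OF u h0(1)] pproj_weight[OF v h0(1)]
    by (simp add: vec_eq_iff algebra_simps)
  finally show ?thesis using h0(2) vector_mul_lcancel unfolding M_def by blast
qed

end

text \<open>A basis x_1..x_q, xt_1..xt_q of the lambda-weight space in g1, symplectic for
  b(-, theta -), with k- and p-components y, yt and z, zt.\<close>
locale symplectic_basis = root_setting br g0 g1 \<theta> b a lam A
  for br :: "'n::finite cvec \<Rightarrow> 'n cvec \<Rightarrow> 'n cvec" and g0 g1 \<theta> b a lam A +
  fixes q :: nat and x xt y yt z zt :: "nat \<Rightarrow> 'n cvec"
  assumes basis_span: "vec.span (x ` {1..q} \<union> xt ` {1..q}) = wspace br a g1 lam"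
    and symp: "\<forall>i\<in>{1..q}. \<forall>j\<in>{1..q}.
                 b (x i) (\<theta> (x j)) = 0 \<and> b (xt i) (\<theta> (xt j)) = 0 \<and>
                 b (x i) (\<theta> (xt j)) = 2 * kron i j"
    and decomp: "\<forall>j\<in>{1..q}. y j \<in> kpart \<theta> \<and> z j \<in> ppart \<theta> \<and> x j = y j + z j \<and>
                   yt j \<in> kpart \<theta> \<and> zt j \<in> ppart \<theta> \<and> xt j = yt j + zt j"
begin

text \<open>The basis vectors lie in W, their components are the projections, and their pairings
  b(-, theta -) are given by the symplectic normalisation.\<close>
lemma basis_in_W:
  assumes "i \<in> {1..q}"
  shows "x i \<in> W" "xt i \<in> W"
proof -
  have "x i \<in> x ` {1..q} \<union> xt ` {1..q}" "xt i \<in> x ` {1..q} \<union> xt ` {1..q}"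
    using assms by blast+
  then show "x i \<in> W" "xt i \<in> W" using vec.span_base basis_span by metis+
qed

lemma basis_components:
  assumes "j \<in> {1..q}"
  shows "y j = kproj (x j)" "z j = pproj (x j)" "yt j = kproj (xt j)" "zt j = pproj (xt j)"
proof -
  have "\<theta> (y j) = y j" "\<theta> (z j) = - z j" "x j = y j + z j"
    "\<theta> (yt j) = yt j" "\<theta> (zt j) = - zt j" "xt j = yt j + zt j"
    using decomp assms unfolding kpart_def ppart_def by simp_all
  then show "y j = kproj (x j)" "z j = pproj (x j)" "yt j = kproj (xt j)" "zt j = pproj (xt j)"
    using projections_of_decomposition by simp_all
qed

lemma basis_pairing:
  assumes i: "i \<in> {1..q}" and j: "j \<in> {1..q}"
  shows "b (x i) (\<theta> (x j)) = 0" "b (xt i) (\<theta> (xt j)) = 0"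
    "b (x i) (\<theta> (xt j)) = 2 * kron i j" "b (xt i) (\<theta> (x j)) = - 2 * kron i j"
proof -
  show "b (x i) (\<theta> (x j)) = 0" "b (xt i) (\<theta> (xt j)) = 0" "b (x i) (\<theta> (xt j)) = 2 * kron i j"
    using symp i j by simp_all
  have "b (xt i) (\<theta> (x j)) = - b (\<theta> (x j)) (xt i)"
    using form_skew_odd[OF W_g1 theta_g1[OF W_g1]] basis_in_W i j by blast
  also have "\<dots> = - b (x j) (\<theta> (xt i))" by (simp only: form_theta_swap)
  also have "\<dots> = - 2 * kron i j" using symp i j by (simp add: kron_def)
  finally show "b (xt i) (\<theta> (x j)) = - 2 * kron i j" .
qed

lemmas basis_facts = basis_in_W basis_components basis_pairing

text \<open>The four parts of the theorem, instantiating the general bracket relations.\<close>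
lemma part_i:
  assumes "i \<in> {1..q}" "j \<in> {1..q}"
  shows "br (y i) (z j) = 0 \<and> br (yt i) (zt j) = 0 \<and>
    br (yt i) (z j) = kron i j *s A \<and> - br (y i) (zt j) = kron i j *s A"
  using assms by (simp add: basis_facts bracket_k_p)

lemma part_ii:
  assumes "i \<in> {1..q}" "j \<in> {1..q}"
  shows "br (y i) (y j) = - br (z i) (z j) \<and> br (yt i) (yt j) = - br (zt i) (zt j) \<and>
    br (y i) (yt j) = - br (z i) (zt j)"
  using assms by (simp add: basis_facts bracket_k_k)

lemma part_iii:
  assumes "i \<in> {1..q}" "j \<in> {1..q}" "k \<in> {1..q}"
  shows "br (br (y i) (y j)) (y k) = 0 \<and> br (br (yt i) (yt j)) (yt k) = 0 \<and>
    br (br (y i) (y j)) (yt k) = b A A *s (kron j k *s y i + kron i k *s y j) \<and>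
    br (br (yt i) (yt j)) (y k) = - (b A A *s (kron j k *s yt i + kron i k *s yt j)) \<and>
    br (br (y i) (yt j)) (y k) = - (b A A *s (kron j k *s y i)) \<and>
    br (br (y i) (yt j)) (yt k) = b A A *s (kron i k *s yt j)"
  using assms by (simp add: basis_facts bracket_kk_k kron_def vec_eq_iff)

lemma part_iv:
  assumes "i \<in> {1..q}" "j \<in> {1..q}" "k \<in> {1..q}"
  shows "br (br (y i) (y j)) (z k) = 0 \<and> br (br (yt i) (yt j)) (zt k) = 0 \<and>
    br (br (y i) (y j)) (zt k) = b A A *s (kron j k *s z i + kron i k *s z j) \<and>
    br (br (yt i) (yt j)) (z k) = - (b A A *s (kron j k *s zt i + kron i k *s zt j)) \<and>
    br (br (y i) (yt j)) (z k) = - (b A A *s (kron j k *s z i)) \<and>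
    br (br (y i) (yt j)) (zt k) = b A A *s (kron i k *s zt j)"
  using assms by (simp add: basis_facts bracket_kk_p kron_def vec_eq_iff)

end

text \<open>The main theorem: the hypotheses make the data a symplectic basis in the above sense.\<close>
theorem mainTheorem8:
  fixes br :: "'n::finite cvec \<Rightarrow> 'n cvec \<Rightarrow> 'n cvec"
    and g0 g1 a :: "'n cvec set"
    and \<theta> :: "'n cvec \<Rightarrow> 'n cvec"
    and b :: "'n cvec \<Rightarrow> 'n cvec \<Rightarrow> complex"
    and lam :: "'n cvec \<Rightarrow> complex"
    and Alam :: "'n cvec"
    and q :: nat
    and x xt y yt z zt :: "nat \<Rightarrow> 'n cvec"
  assumes pair: "reductive_symmetric_superpair br g0 g1 \<theta> b"
    and cartan: "even_cartan_subspace br g0 \<theta> a"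
    and root1: "is_root br a g1 lam"
    and not_root0: "\<not> is_root br a g0 (\<lambda>h. 2 * lam h)"
    and A_mem: "Alam \<in> a"
    and A_def: "\<forall>h\<in>a. b Alam h = lam h"
    and basis_indep: "vec.independent (x ` {1..q} \<union> xt ` {1..q})"
    and basis_inj: "inj_on x {1..q}" "inj_on xt {1..q}" "x ` {1..q} \<inter> xt ` {1..q} = {}"
    and basis_span: "vec.span (x ` {1..q} \<union> xt ` {1..q}) = wspace br a g1 lam"
    and symp: "\<forall>i\<in>{1..q}. \<forall>j\<in>{1..q}.
                 b (x i) (\<theta> (x j)) = 0 \<and> b (xt i) (\<theta> (xt j)) = 0 \<and>
                 b (x i) (\<theta> (xt j)) = 2 * kron i j"
    and decomp: "\<forall>j\<in>{1..q}. y j \<in> kpart \<theta> \<and> z j \<in> ppart \<theta> \<and> x j = y j + z j \<and>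
                   yt j \<in> kpart \<theta> \<and> zt j \<in> ppart \<theta> \<and> xt j = yt j + zt j"
  shows "\<forall>i\<in>{1..q}. \<forall>j\<in>{1..q}. \<forall>k\<in>{1..q}.
     let ll = b Alam Alam in
     \<comment> \<open>(i)\<close>
     br (y i) (z j) = 0 \<and> br (yt i) (zt j) = 0 \<and>
     br (yt i) (z j) = kron i j *s Alam \<and> - br (y i) (zt j) = kron i j *s Alam \<and>
     \<comment> \<open>(ii)\<close>
     br (y i) (y j) = - br (z i) (z j) \<and>
     br (yt i) (yt j) = - br (zt i) (zt j) \<and>
     br (y i) (yt j) = - br (z i) (zt j) \<and>
     \<comment> \<open>(iii)\<close>
     br (br (y i) (y j)) (y k) = 0 \<and> br (br (yt i) (yt j)) (yt k) = 0 \<and>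
     br (br (y i) (y j)) (yt k) = ll *s (kron j k *s y i + kron i k *s y j) \<and>
     br (br (yt i) (yt j)) (y k) = - (ll *s (kron j k *s yt i + kron i k *s yt j)) \<and>
     br (br (y i) (yt j)) (y k) = - (ll *s (kron j k *s y i)) \<and>
     br (br (y i) (yt j)) (yt k) = ll *s (kron i k *s yt j) \<and>
     \<comment> \<open>(iv)\<close>
     br (br (y i) (y j)) (z k) = 0 \<and> br (br (yt i) (yt j)) (zt k) = 0 \<and>
     br (br (y i) (y j)) (zt k) = ll *s (kron j k *s z i + kron i k *s z j) \<and>
     br (br (yt i) (yt j)) (z k) = - (ll *s (kron j k *s zt i + kron i k *s zt j)) \<and>
     br (br (y i) (yt j)) (z k) = - (ll *s (kron j k *s z i)) \<and>
     br (br (y i) (yt j)) (zt k) = ll *s (kron i k *s zt j)"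
proof -
  interpret symplectic_basis br g0 g1 \<theta> b a lam Alam q x xt y yt z zt
    by unfold_locales (fact pair cartan root1 not_root0 A_mem A_def basis_span symp decomp)+
  show ?thesis
    unfolding Let_def by (intro ballI conjI; insert part_i part_ii part_iii part_iv; blast)
qed

end
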